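(* Let $T$ be a tree with at least one edge and let $\ell\ge 1$. Then $\chi_s'(T\Box C_{4\ell})=2\Delta(T)+4$, where $C_{4\ell}$ is the cycle of length $4\ell$.
   Context: $\Delta(T)$ is the maximum degree of $T$. The Cartesian product $G\Box H$ has vertex set $V(G)\times V(H)$, with $(a,u)\sim(b,v)$ iff either $a=b$ and $uv\in E(H)$, or $u=v$ and $ab\in E(G)$. A strong edge coloring is a proper edge coloring in which every color class is an induced matching; $\chi_s'(G)$ is the minimum number of colors in such a coloring. *)

theory Defs
  imports Main
begin

(* An edge is its two-element set of end vertices. *)
record 'a ugraph =
  verts :: "'a set"
  edges :: "'a set set"

definition fin_simple_graph :: "'a ugraph \<Rightarrow> bool" where
  "fin_simple_graph G \<longleftrightarrow>
     finite (verts G) \<and> (\<forall>e\<in>edges G. e \<subseteq> verts G \<and> card e = 2)"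

definition connected_graph :: "'a ugraph \<Rightarrow> bool" where
  "connected_graph G \<longleftrightarrow> verts G \<noteq> {} \<and>
     (\<forall>u\<in>verts G. \<forall>v\<in>verts G. (u, v) \<in> {(x, y). {x, y} \<in> edges G}\<^sup>*)"

(* The closing edge, from the last vertex of the list back to the first, is the case
   i = length xs - 1. *)
definition is_cycle_in :: "'a ugraph \<Rightarrow> 'a list \<Rightarrow> bool" where
  "is_cycle_in G xs \<longleftrightarrow> length xs \<ge> 3 \<and> distinct xs \<and> set xs \<subseteq> verts G \<and>
     (\<forall>i<length xs. {xs ! i, xs ! (Suc i mod length xs)} \<in> edges G)"

definition is_tree :: "'a ugraph \<Rightarrow> bool" where
  "is_tree G \<longleftrightarrow> fin_simple_graph G \<and> connected_graph G \<and> (\<nexists>xs. is_cycle_in G xs)"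

definition degree :: "'a ugraph \<Rightarrow> 'a \<Rightarrow> nat" where
  "degree G v = card {e \<in> edges G. v \<in> e}"

(* Only meaningful for finite graphs with at least one vertex. *)
definition max_degree :: "'a ugraph \<Rightarrow> nat" where
  "max_degree G = Max (degree G ` verts G)"

definition cart_prod :: "'a ugraph \<Rightarrow> 'b ugraph \<Rightarrow> ('a \<times> 'b) ugraph" (infixr "\<box>" 70) where
  "G \<box> H = \<lparr> verts = verts G \<times> verts H,
     edges = {{(a, u), (b, v)} | a u b v.
        a \<in> verts G \<and> b \<in> verts G \<and> u \<in> verts H \<and> v \<in> verts H \<and>
        (a = b \<and> {u, v} \<in> edges H \<or> u = v \<and> {a, b} \<in> edges G)} \<rparr>"

(* The cycle C_n on 0, ..., n - 1; only meaningful for n >= 3. *)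
definition cycle_graph :: "nat \<Rightarrow> nat ugraph" where
  "cycle_graph n = \<lparr> verts = {..<n}, edges = {{i, Suc i mod n} | i. i < n} \<rparr>"

definition matching :: "'a ugraph \<Rightarrow> 'a set set \<Rightarrow> bool" where
  "matching G M \<longleftrightarrow> M \<subseteq> edges G \<and> (\<forall>e\<in>M. \<forall>f\<in>M. e \<noteq> f \<longrightarrow> e \<inter> f = {})"

(* The subgraph of G induced by the vertices covered by M has edge set M. *)
definition induced_matching :: "'a ugraph \<Rightarrow> 'a set set \<Rightarrow> bool" where
  "induced_matching G M \<longleftrightarrow> matching G M \<and> {e \<in> edges G. e \<subseteq> \<Union>M} = M"

definition proper_edge_coloring :: "'a ugraph \<Rightarrow> ('a set \<Rightarrow> nat) \<Rightarrow> bool" where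
  "proper_edge_coloring G c \<longleftrightarrow>
     (\<forall>e\<in>edges G. \<forall>f\<in>edges G. e \<noteq> f \<and> e \<inter> f \<noteq> {} \<longrightarrow> c e \<noteq> c f)"

definition strong_edge_coloring :: "'a ugraph \<Rightarrow> ('a set \<Rightarrow> nat) \<Rightarrow> bool" where
  "strong_edge_coloring G c \<longleftrightarrow> proper_edge_coloring G c \<and>
     (\<forall>i. induced_matching G {e \<in> edges G. c e = i})"

definition strong_chromatic_index :: "'a ugraph \<Rightarrow> nat" where
  "strong_chromatic_index G =
     (LEAST k. \<exists>c. strong_edge_coloring G c \<and> c ` edges G \<subseteq> {..<k})"

lemma fin_simple_graph_finite_edges:
  assumes "fin_simple_graph G" shows "finite (edges G)"
  by (rule finite_subset[of _ "Pow (verts G)"])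
    (use assms in \<open>auto simp: fin_simple_graph_def\<close>)

lemma strong_edge_coloring_exists:
  assumes "fin_simple_graph G"
  shows "\<exists>k c. strong_edge_coloring G c \<and> c ` edges G \<subseteq> {..<k}"
proof -
  obtain c :: "'a set \<Rightarrow> nat" and n where c: "c ` edges G = {i. i < n}" "inj_on c (edges G)"
    using finite_imp_inj_to_nat_seg[OF fin_simple_graph_finite_edges[OF assms]] by metis
  have sub: "e = f" if "e \<in> edges G" "f \<in> edges G" "f \<subseteq> e" for e f
    using that assms unfolding fin_simple_graph_def
    by (metis card_subset_eq finite_subset)
  have cls: "induced_matching G {e \<in> edges G. c e = i}" for i
  proof (cases "\<exists>e\<in>edges G. c e = i")
    case True
    then obtain e where e: "e \<in> edges G" "c e = i" by blast
    then have eq: "{e \<in> edges G. c e = i} = {e}" using c(2) by (auto dest: inj_onD)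
    show ?thesis unfolding eq induced_matching_def matching_def using e sub by auto
  next
    case False
    then have eq: "{e \<in> edges G. c e = i} = {}" by blast
    show ?thesis unfolding eq induced_matching_def matching_def
      using assms by (auto simp: fin_simple_graph_def)
  qed
  have "strong_edge_coloring G c"
    unfolding strong_edge_coloring_def proper_edge_coloring_def
    using cls c(2) by (auto dest: inj_onD)
  then show ?thesis using c(1) by (metis lessThan_def order_refl)
qed

lemma strong_chromatic_index_attained:
  assumes "fin_simple_graph G"
  shows "\<exists>c. strong_edge_coloring G c \<and> c ` edges G \<subseteq> {..<strong_chromatic_index G}"
  unfolding strong_chromatic_index_def
  by (rule LeastI_ex) (rule strong_edge_coloring_exists[OF assms])

lemma fin_simple_graph_cart_prod:
  assumes "fin_simple_graph G" "fin_simple_graph H"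
  shows "fin_simple_graph (G \<box> H)"
  using assms unfolding fin_simple_graph_def cart_prod_def
  by (fastforce simp: card_2_iff doubleton_eq_iff)

lemma fin_simple_graph_cycle_graph:
  assumes "n \<ge> 3"
  shows "fin_simple_graph (cycle_graph n)"
proof -
  have "i \<noteq> Suc i mod n" if "i < n" for i
    using that assms by (auto simp: mod_Suc)
  then show ?thesis
    using assms by (auto simp: fin_simple_graph_def cycle_graph_def)
qed

end

theory Submission
  imports Defs
begin

text \<open>
  Lower bound: if \<open>v\<close> has maximum degree in \<open>T\<close> and \<open>w\<close> is a neighbour of \<open>v\<close>, then the
  \<open>2\<Delta> + 3\<close> edges at \<open>(v, 0)\<close> or \<open>(v, 1)\<close>, together with the edge opposite to
  \<open>(v, 0)(v, 1)\<close> in the four-cycle over \<open>vw\<close>, pairwise meet a common edge.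

  Upper bound: the copies of cycle edges get four colors, \<open>i + 2 b(t)\<close> modulo 4 for the edge from
  \<open>(t, i)\<close> to \<open>(t, i + 1)\<close>, where \<open>b\<close> is a bipartition of \<open>T\<close>. The copies of
  tree edges get \<open>2\<Delta>\<close> colors \<open>(p, \<sigma>)\<close>: \<open>p\<close> is a proper edge coloring of \<open>T\<close> with \<open>\<Delta>\<close> colors, and
  the bit \<open>\<sigma>\<close>, flipped between consecutive layers, has to separate edges of \<open>T\<close> with the same \<open>p\<close>
  that are joined by an edge. For this, every vertex \<open>u\<close> carries bits \<open>s u q\<close> for all \<open>q\<close>, such that
  the bits of adjacent vertices \<open>u\<close>, \<open>v\<close> agree exactly at \<open>q = p {u, v}\<close>; this common bit is \<open>\<sigma>\<close>.
  Such bits are constructed by adding leaf edges one at a time.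
\<close>

section \<open>Ends of edges, strong colorings and edges of products\<close>

lemma edge_endsE:
  assumes "fin_simple_graph G" "e \<in> edges G"
  obtains u v where "e = {u, v}" "u \<noteq> v" "u \<in> verts G" "v \<in> verts G"
proof -
  have "card e = 2" "e \<subseteq> verts G" using assms by (auto simp: fin_simple_graph_def)
  then show thesis using that by (auto simp: card_2_iff)
qed

lemma edge_other_endE:
  assumes "fin_simple_graph G" "e \<in> edges G" "u \<in> e"
  obtains v where "e = {u, v}" "u \<noteq> v" "v \<in> verts G"
  using assms(3) edge_endsE[OF assms(1,2)] by (metis insertE insert_commute singletonD)

text \<open>If two distinct edges of one color meet \<open>g\<close>, then they share a vertex or
  \<open>g\<close> joins them, and in the latter case \<open>g\<close> is spanned by the color class
  without belonging to it. Conversely, \<open>g = e\<close> gives properness.\<close>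

lemma strong_edge_coloring_iff:
  assumes "fin_simple_graph G"
  shows "strong_edge_coloring G c \<longleftrightarrow>
    (\<forall>e\<in>edges G. \<forall>f\<in>edges G. \<forall>g\<in>edges G.
       e \<noteq> f \<and> e \<inter> g \<noteq> {} \<and> f \<inter> g \<noteq> {} \<longrightarrow> c e \<noteq> c f)"
    (is "_ \<longleftrightarrow> ?R")
proof
  assume s: "strong_edge_coloring G c"
  show ?R
  proof (intro ballI impI notI)
    fix e f g
    assume e: "e \<in> edges G" and f: "f \<in> edges G" and g: "g \<in> edges G"
      and ne: "e \<noteq> f \<and> e \<inter> g \<noteq> {} \<and> f \<inter> g \<noteq> {}" and eq: "c e = c f"
    define M where "M = {h \<in> edges G. c h = c e}"
    have M: "induced_matching G M"
      using s by (simp add: strong_edge_coloring_def M_def)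
    then have disj: "\<And>x y. x \<in> M \<Longrightarrow> y \<in> M \<Longrightarrow> x \<inter> y \<noteq> {} \<Longrightarrow> x = y"
      unfolding induced_matching_def matching_def by blast
    have eM: "e \<in> M" "f \<in> M" using e f eq by (auto simp: M_def)
    obtain a b where ab: "a \<in> e" "a \<in> g" "b \<in> f" "b \<in> g" using ne by blast
    have "a \<noteq> b" using disj[OF eM] ab ne by blast
    moreover have "card g = 2" using g assms by (auto simp: fin_simple_graph_def)
    ultimately have "g = {a, b}" using ab by (auto simp: card_2_iff)
    then have "g \<subseteq> \<Union>M" using ab eM by blast
    then have "g \<in> M" using M g unfolding induced_matching_def by blast
    then show False using disj[of e g] disj[of f g] eM ne by blast
  qed
next
  assume R: ?R
  have proper: "proper_edge_coloring G c"
    unfolding proper_edge_coloring_def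
  proof (intro ballI impI)
    fix e f assume "e \<in> edges G" "f \<in> edges G" "e \<noteq> f \<and> e \<inter> f \<noteq> {}"
    then show "c e \<noteq> c f" using R[rule_format, of e f e] by blast
  qed
  have "induced_matching G {e \<in> edges G. c e = i}" for i
  proof -
    define M where "M = {e \<in> edges G. c e = i}"
    have "matching G M"
      using proper unfolding matching_def M_def proper_edge_coloring_def by blast
    moreover have "g \<in> M" if g: "g \<in> edges G" "g \<subseteq> \<Union>M" for g
    proof -
      have "card g = 2" using g assms by (auto simp: fin_simple_graph_def)
      then obtain a b where ab: "g = {a, b}" "a \<noteq> b" by (auto simp: card_2_iff)
      obtain e f where ef: "e \<in> M" "f \<in> M" "a \<in> e" "b \<in> f" using g ab by blast
      then have "e = f"
        using R[rule_format, of e f g] g ab by (auto simp: M_def)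
      moreover have "card e = 2" using ef assms by (auto simp: fin_simple_graph_def M_def)
      ultimately have "g = e" using ab ef by (auto simp: card_2_iff)
      then show ?thesis using ef by simp
    qed
    ultimately show ?thesis
      unfolding induced_matching_def M_def[symmetric] by (auto simp: M_def)
  qed
  with proper show "strong_edge_coloring G c" by (simp add: strong_edge_coloring_def)
qed

text \<open>In product form, an edge is recovered from its two projections, and intersections can be
  computed factor by factor.\<close>

lemma edges_cart_prod:
  assumes "fin_simple_graph G" "fin_simple_graph H"
  shows "edges (G \<box> H) =
    {e \<times> {u} | e u. e \<in> edges G \<and> u \<in> verts H} \<union>
    {{a} \<times> e | a e. a \<in> verts G \<and> e \<in> edges H}" (is "?L = ?R")
proof
  show "?L \<subseteq> ?R"
  proof
    fix x assume "x \<in> ?L"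
    then obtain a u b v where x: "x = {(a, u), (b, v)}"
      and V: "a \<in> verts G" "b \<in> verts G" "u \<in> verts H" "v \<in> verts H"
      and E: "a = b \<and> {u, v} \<in> edges H \<or> u = v \<and> {a, b} \<in> edges G"
      by (auto simp: cart_prod_def)
    from E show "x \<in> ?R"
    proof
      assume "a = b \<and> {u, v} \<in> edges H"
      moreover from this have "x = {a} \<times> {u, v}" using x by auto
      ultimately show ?thesis using V by blast
    next
      assume "u = v \<and> {a, b} \<in> edges G"
      moreover from this have "x = {a, b} \<times> {u}" using x by auto
      ultimately show ?thesis using V by blast
    qed
  qed
next
  have "e \<times> {u} \<in> ?L" if e: "e \<in> edges G" and u: "u \<in> verts H" for e u
  proof -
    obtain a b where ab: "e = {a, b}" "a \<noteq> b" "a \<in> verts G" "b \<in> verts G"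
      by (rule edge_endsE[OF assms(1) e])
    then have "e \<times> {u} = {(a, u), (b, u)}" by auto
    then show ?thesis using e u ab unfolding cart_prod_def by auto
  qed
  moreover have "{a} \<times> e \<in> ?L" if a: "a \<in> verts G" and e: "e \<in> edges H" for e a
  proof -
    obtain u v where uv: "e = {u, v}" "u \<noteq> v" "u \<in> verts H" "v \<in> verts H"
      by (rule edge_endsE[OF assms(2) e])
    then have "{a} \<times> e = {(a, u), (a, v)}" by auto
    then show ?thesis using a e uv unfolding cart_prod_def by auto
  qed
  ultimately show "?R \<subseteq> ?L" by blast
qed

section \<open>Leaves and labellings of forests\<close>

text \<open>The first vertex of a longest path is a leaf: any neighbour other than the second vertex
  would prolong the path or close a cycle.\<close>

lemma acyclic_graph_has_leaf_edge:
  assumes G: "fin_simple_graph G" and acyclic: "\<nexists>xs. is_cycle_in G xs"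
    and ne: "edges G \<noteq> {}"
  obtains v t where "{v, t} \<in> edges G" "\<And>f. f \<in> edges G \<Longrightarrow> v \<in> f \<Longrightarrow> f = {v, t}"
proof -
  define P where "P xs \<longleftrightarrow> distinct xs \<and> set xs \<subseteq> verts G \<and>
    (\<forall>i. Suc i < length xs \<longrightarrow> {xs ! i, xs ! Suc i} \<in> edges G)" for xs
  obtain e where e: "e \<in> edges G" using ne by blast
  obtain a b where ab: "e = {a, b}" "a \<noteq> b" "a \<in> verts G" "b \<in> verts G"
    by (rule edge_endsE[OF G e])
  have P2: "P [a, b]" using ab e by (simp add: P_def)
  have bound: "length xs \<le> card (verts G)" if "P xs" for xs
    using that G card_mono[of "verts G" "set xs"] distinct_card[of xs]
    by (auto simp: P_def fin_simple_graph_def)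
  obtain xs where xs: "P xs" and max: "\<And>ys. P ys \<Longrightarrow> length ys \<le> length xs"
    using ex_has_greatest_nat[of P "[a, b]" length "Suc (card (verts G))"] P2 bound
    by (metis le_imp_less_Suc)
  have "length xs \<ge> 2" using max[OF P2] by simp
  then obtain x y zs where xyz: "xs = x # y # zs"
    by (metis Suc_le_length_iff numeral_2_eq_2)
  have xy: "{x, y} \<in> edges G" using xs[unfolded P_def] xyz by force
  have "f = {x, y}" if f: "f \<in> edges G" "x \<in> f" for f
  proof -
    obtain z where z: "f = {x, z}" "x \<noteq> z" "z \<in> verts G"
      by (rule edge_other_endE[OF G f])
    have "z \<in> set xs"
    proof (rule ccontr)
      assume "z \<notin> set xs"
      moreover have "{(z # xs) ! i, (z # xs) ! Suc i} \<in> edges G"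
        if "Suc i < length (z # xs)" for i
        using that xs f z xyz by (cases i) (auto simp: P_def insert_commute)
      ultimately have "P (z # xs)" using xs z by (auto simp: P_def)
      from max[OF this] show False by simp
    qed
    then obtain j where j: "j < length xs" "xs ! j = z" by (auto simp: in_set_conv_nth)
    have "j \<noteq> 0" using j z xyz by (cases j) auto
    \<comment> \<open>Otherwise the initial segment of the path from \<open>x\<close> to
      \<open>z\<close> is closed to a cycle by \<open>f\<close>.\<close>
    moreover have "\<not> j \<ge> 2"
    proof
      assume j2: "j \<ge> 2"
      have "is_cycle_in G (take (Suc j) xs)"
        unfolding is_cycle_in_def
      proof (intro conjI allI impI)
        show "3 \<le> length (take (Suc j) xs)" using j j2 by simp
        show "distinct (take (Suc j) xs)" using xs by (simp add: P_def)
        show "set (take (Suc j) xs) \<subseteq> verts G"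
          using xs set_take_subset[of "Suc j" xs] by (auto simp: P_def)
        fix i assume i: "i < length (take (Suc j) xs)"
        show "{take (Suc j) xs ! i, take (Suc j) xs ! (Suc i mod length (take (Suc j) xs))} \<in> edges G"
        proof (cases "i = j")
          case True
          moreover have "xs ! 0 = x" using xyz by simp
          ultimately show ?thesis using j z f by (simp add: insert_commute)
        next
          case False
          then show ?thesis using i j xs by (auto simp: P_def)
        qed
      qed
      then show False using acyclic by blast
    qed
    ultimately have "j = 1" by simp
    then show ?thesis using j xyz z by simp
  qed
  with xy that show thesis by blast
qed

text \<open>Induction on the number of edges, deleting a leaf edge but keeping its ends. Forests and
  a fixed degree bound \<open>D\<close> are used because both survive the deletion, whereas
  connectedness does not.\<close>

lemma forest_labelling:
  assumes "fin_simple_graph G" "\<nexists>xs. is_cycle_in G xs" "\<And>v. v \<in> verts G \<Longrightarrow> degree G v \<le> D"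
  shows "\<exists>(p :: 'a set \<Rightarrow> nat) (s :: 'a \<Rightarrow> nat \<Rightarrow> bool) (b :: 'a \<Rightarrow> bool).
    (\<forall>e\<in>edges G. p e < D) \<and> proper_edge_coloring G p \<and>
    (\<forall>u v. {u, v} \<in> edges G \<longrightarrow> (\<forall>q. s u q = s v q \<longleftrightarrow> q = p {u, v}) \<and> b u \<noteq> b v)"
  using assms
proof (induction "card (edges G)" arbitrary: G)
  case 0
  then have "edges G = {}" using fin_simple_graph_finite_edges card_0_eq by metis
  then show ?case by (auto simp: proper_edge_coloring_def)
next
  case (Suc n)
  have fin: "finite (edges G)" by (rule fin_simple_graph_finite_edges) fact
  have "edges G \<noteq> {}" using Suc(2) by auto
  then obtain v t where vt: "{v, t} \<in> edges G"
    and leaf: "\<And>f. f \<in> edges G \<Longrightarrow> v \<in> f \<Longrightarrow> f = {v, t}"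
    using acyclic_graph_has_leaf_edge[OF Suc(3,4)] by metis
  have "v \<noteq> t" "t \<in> verts G" using vt Suc(3) by (auto simp: fin_simple_graph_def)
  define H where "H = G\<lparr>edges := edges G - {{v, t}}\<rparr>"
  have E: "edges H = edges G - {{v, t}}" and V: "verts H = verts G" by (simp_all add: H_def)
  have simple: "fin_simple_graph H" using Suc(3) by (simp add: fin_simple_graph_def E V)
  have acyc: "\<nexists>xs. is_cycle_in H xs" using Suc(4) by (auto simp: is_cycle_in_def E V)
  have sub: "{e \<in> edges H. u \<in> e} \<subseteq> {e \<in> edges G. u \<in> e}" for u by (auto simp: E)
  have deg: "degree H u \<le> D" if "u \<in> verts H" for u
    using card_mono[OF _ sub[of u]] fin Suc(5)[of u] that by (auto simp: degree_def V)
  have "n = card (edges H)" using Suc(2) vt fin by (simp add: E)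
  from Suc(1)[OF this simple acyc deg] obtain p s b where
    p: "\<forall>e\<in>edges H. p e < D" and proper: "proper_edge_coloring H p" and
    sb: "\<forall>u v. {u, v} \<in> edges H \<longrightarrow>
      (\<forall>q. s u q = (s v q :: bool) \<longleftrightarrow> q = p {u, v}) \<and> b u \<noteq> (b v :: bool)"
    by blast
  \<comment> \<open>The colors already present at \<open>t\<close>; they number less than
    \<open>degree G t\<close>, so one of the \<open>D\<close> colors is free for the leaf
    edge.\<close>
  define U where "U = p ` {e \<in> edges H. t \<in> e}"
  have "card U \<le> degree H t"
    unfolding U_def degree_def by (rule card_image_le) (simp add: E fin)
  also have "{e \<in> edges H. t \<in> e} \<subset> {e \<in> edges G. t \<in> e}" using vt by (auto simp: E)
  then have "degree H t < degree G t"
    unfolding degree_def by (rule psubset_card_mono[rotated]) (simp add: fin)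
  also have "\<dots> \<le> D" using Suc(5) \<open>t \<in> verts G\<close> .
  finally have "card U < card {..<D}" by simp
  then have "\<not> {..<D} \<subseteq> U" using card_mono[of U "{..<D}"] fin by (auto simp: U_def E)
  then obtain q where q: "q < D" "q \<notin> U" by auto
  define p' where "p' = p({v, t} := q)"
  \<comment> \<open>No edge of \<open>H\<close> contains \<open>v\<close>, so its bits can be chosen
    freely relative to those of \<open>t\<close>.\<close>
  define s' where "s' = s(v := \<lambda>r. if r = q then s t r else \<not> s t r)"
  define b' where "b' = b(v := \<not> b t)"
  have q': "p e \<noteq> q" if "e \<in> edges H" "t \<in> e" for e using q that by (auto simp: U_def)
  have "\<forall>e\<in>edges G. p' e < D" using p q by (auto simp: p'_def E)
  moreover have "proper_edge_coloring G p'"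
    unfolding proper_edge_coloring_def
  proof (intro ballI impI)
    fix e f assume ef: "e \<in> edges G" "f \<in> edges G" "e \<noteq> f \<and> e \<inter> f \<noteq> {}"
    consider "e = {v, t}" | "f = {v, t}" | "e \<noteq> {v, t}" "f \<noteq> {v, t}" by blast
    then show "p' e \<noteq> p' f"
    proof cases
      case 1
      then have "t \<in> f" "f \<noteq> {v, t}" using ef leaf[of f] by auto
      then show ?thesis using q'[of f] ef 1 by (auto simp: p'_def E)
    next
      case 2
      then have "t \<in> e" "e \<noteq> {v, t}" using ef leaf[of e] by auto
      then show ?thesis using q'[of e] ef 2 by (auto simp: p'_def E)
    next
      case 3
      then show ?thesis using proper ef by (auto simp: p'_def E proper_edge_coloring_def)
    qed
  qed
  moreover have "(\<forall>r. s' x r = s' y r \<longleftrightarrow> r = p' {x, y}) \<and> b' x \<noteq> b' y"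
    if xy: "{x, y} \<in> edges G" for x y
  proof (cases "{x, y} = {v, t}")
    case True
    then show ?thesis using \<open>v \<noteq> t\<close>
      by (auto simp: doubleton_eq_iff s'_def p'_def b'_def insert_commute)
  next
    case False
    then have "x \<noteq> v" "y \<noteq> v" using leaf[OF xy] by auto
    then show ?thesis using sb[rule_format, of x y] xy False by (simp add: s'_def p'_def b'_def E)
  qed
  ultimately show ?case by blast
qed

section \<open>The upper bound\<close>

lemma cycle_graph_simps:
  "verts (cycle_graph n) = {..<n}"
  "edges (cycle_graph n) = {{i, Suc i mod n} | i. i < n}"
  by (simp_all add: cycle_graph_def)

lemma cycle_edges_meet:
  assumes "i < n" "j < n" "{i, Suc i mod n} \<inter> {j, Suc j mod n} \<noteq> {}"
  shows "i = j \<or> i = Suc j mod n \<or> j = Suc i mod n"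
  using assms by (auto simp: mod_Suc split: if_splits)

lemma inj_on_cycle_edge:
  assumes "n \<ge> 3"
  shows "inj_on (\<lambda>i. {i, Suc i mod n}) {..<n}"
  using assms by (auto simp: inj_on_def doubleton_eq_iff mod_Suc split: if_splits)

text \<open>Copies of tree edges get colors below \<open>2 * D\<close>, copies of cycle edges the
  four colors from \<open>2 * D\<close> on. Hence conflicts can only arise within one kind;
  \<open>tree_tree\<close> and \<open>cycle_cycle\<close> exclude them.\<close>

lemma strong_edge_coloring_forest_cycle:
  fixes T :: "'a ugraph"
  assumes T: "fin_simple_graph T" "\<nexists>xs. is_cycle_in T xs"
    and D: "\<And>v. v \<in> verts T \<Longrightarrow> degree T v \<le> D" and l: "l \<ge> 1"
  obtains c where "strong_edge_coloring (T \<box> cycle_graph (4 * l)) c"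
    "c ` edges (T \<box> cycle_graph (4 * l)) \<subseteq> {..<2 * D + 4}"
proof -
  define n where "n = 4 * l"
  have n: "n \<ge> 3" "even n" "4 dvd n" using l by (auto simp: n_def)
  note C = fin_simple_graph_cycle_graph[OF n(1)]
  note edgesG = edges_cart_prod[OF T(1) C]
  obtain p s b where p: "\<forall>e\<in>edges T. p e < D" and proper: "proper_edge_coloring T p" and
    sb: "\<forall>u v. {u, v} \<in> edges T \<longrightarrow>
      (\<forall>q. s u q = (s v q :: bool) \<longleftrightarrow> q = p {u, v}) \<and> b u \<noteq> (b v :: bool)"
    using forest_labelling[OF T D] by blast
  have s: "s u q = s v q \<longleftrightarrow> q = p {u, v}" and b: "b u \<noteq> b v"
    if "{u, v} \<in> edges T" for u v q
    using sb that by blast+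
  \<comment> \<open>Both ends of \<open>E\<close> have the same bit at \<open>p E\<close>, so the
    quantifier merely selects that common bit.\<close>
  define \<sigma> where "\<sigma> E = (\<exists>t\<in>E. s t (p E))" for E
  define h where "h = inv_into {..<n} (\<lambda>i. {i, Suc i mod n})"
  have \<sigma>: "\<sigma> E = s t (p E)" if E: "E \<in> edges T" "t \<in> E" for E t
  proof -
    obtain u where "E = {t, u}" "t \<noteq> u" "u \<in> verts T"
      by (rule edge_other_endE[OF T(1) E])
    then show ?thesis using E s[of t u "p E"] by (auto simp: \<sigma>_def)
  qed
  have h: "h {i, Suc i mod n} = i" if "i < n" for i
    unfolding h_def using inv_into_f_f[OF inj_on_cycle_edge[OF n(1)], of i] that by simp
  \<comment> \<open>The second projection is a singleton exactly for copies of tree edges. Their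
    pair of \<open>p\<close> and layer-dependent bit is encoded as quotient and remainder by
    2.\<close>
  define c where "c e = (if is_singleton (snd ` e)
    then 2 * p (fst ` e) + of_bool (\<sigma> (fst ` e) = even (the_elem (snd ` e)))
    else 2 * D + (h (snd ` e) + 2 * of_bool (b (the_elem (fst ` e)))) mod 4)" for e
  have c1: "c (E \<times> {i}) = 2 * p E + of_bool (\<sigma> E = even i)" if "E \<in> edges T" for E i
  proof -
    have "E \<noteq> {}" using that T(1) by (auto simp: fin_simple_graph_def)
    then show ?thesis by (simp add: c_def)
  qed
  have c2: "c ({t} \<times> {i, Suc i mod n}) = 2 * D + (i + 2 * of_bool (b t)) mod 4"
    if "i < n" for t i
  proof -
    have "i \<noteq> Suc i mod n" using n(1) that by (auto simp: mod_Suc)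
    then have "\<not> is_singleton {i, Suc i mod n}" by (simp add: is_singleton_altdef)
    then show ?thesis using h[OF that] by (simp add: c_def)
  qed
  \<comment> \<open>Since 4 divides \<open>n\<close>, residues modulo 4, and likewise parities,
    continue consistently across the closing edge of the cycle.\<close>
  have mod4: "Suc i mod n mod 4 = Suc i mod 4" for i using n(3) by (rule mod_mod_cancel)
  have par: "even (Suc i mod n) = odd i" for i
    using n(2) by (simp add: dvd_mod_iff)
  have type: "(\<exists>E i. e = E \<times> {i} \<and> E \<in> edges T \<and> i < n) \<or>
      (\<exists>t i. e = {t} \<times> {i, Suc i mod n} \<and> t \<in> verts T \<and> i < n)"
    if "e \<in> edges (T \<box> cycle_graph n)" for e
    using that unfolding edgesG cycle_graph_simps by blast
  have lt: "c (E \<times> {i}) < 2 * D" if "E \<in> edges T" for E i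
    using p that by (fastforce simp: c1[OF that] of_bool_def)
  have ge: "c ({t} \<times> {i, Suc i mod n}) \<ge> 2 * D" if "i < n" for t i
    unfolding c2[OF that] by simp
  have range: "c ` edges (T \<box> cycle_graph n) \<subseteq> {..<2 * D + 4}"
  proof
    fix x assume "x \<in> c ` edges (T \<box> cycle_graph n)"
    then obtain e where e: "e \<in> edges (T \<box> cycle_graph n)" "x = c e" by blast
    from type[OF e(1)] show "x \<in> {..<2 * D + 4}"
    proof (elim disjE exE conjE)
      fix E i assume "e = E \<times> {i}" "E \<in> edges T"
      then show ?thesis using lt[of E i] e(2) by simp
    next
      fix t i assume "e = {t} \<times> {i, Suc i mod n}" "i < n"
      then show ?thesis using c2[of i t] e by simp
    qed
  qed
  have tree_tree: False
    if E: "E \<in> edges T" and F: "F \<in> edges T" and ne: "E \<times> {i} \<noteq> F \<times> {j}"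
      and eq: "c (E \<times> {i}) = c (F \<times> {j})" and g: "g \<in> edges (T \<box> cycle_graph n)"
      and meet: "(E \<times> {i}) \<inter> g \<noteq> {}" "(F \<times> {j}) \<inter> g \<noteq> {}" for E F i j g
  proof -
    have pEF: "p E = p F"
      using arg_cong[OF eq, of "\<lambda>x. x div 2"] by (simp add: c1 E F)
    have sEF: "(\<sigma> E = even i) = (\<sigma> F = even j)"
      using eq by (simp add: c1 E F pEF of_bool_def split: if_splits)
    have disj: "E \<inter> F = {}" if "E \<noteq> F"
      using proper E F pEF that unfolding proper_edge_coloring_def by blast
    from type[OF g] show False
    proof (elim disjE exE conjE)
      fix K k assume K: "g = K \<times> {k}" "K \<in> edges T"
      then have "i = k" "j = k" using meet by auto
      then have EF: "E \<noteq> F" "\<sigma> E = \<sigma> F" using ne sEF by auto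
      obtain u v where u: "u \<in> E" "u \<in> K" and v: "v \<in> F" "v \<in> K" using meet K by auto
      have "u \<noteq> v" using disj EF u v by auto
      moreover have "card K = 2" using K T(1) by (auto simp: fin_simple_graph_def)
      ultimately have Kuv: "K = {u, v}" using u v by (auto simp: card_2_iff)
      have "K \<noteq> E" using disj EF v by auto
      then have "p K \<noteq> p E" using proper K E u unfolding proper_edge_coloring_def by blast
      \<comment> \<open>The bits of adjacent vertices agree only at \<open>p K\<close>; but these
        two bits are \<open>\<sigma> E\<close> and \<open>\<sigma> F\<close>, which are
        equal.\<close>
      then have "s u (p E) \<noteq> s v (p E)" using s[of u v "p E"] K Kuv by auto
      then show False using \<sigma>[OF E u(1)] \<sigma>[OF F v(1)] EF pEF by simp
    next
      \<comment> \<open>Here \<open>E\<close> and \<open>F\<close> are the same tree edge in two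
        consecutive layers, whose opposite parities flip the bit.\<close>
      fix t k assume g: "g = {t} \<times> {k, Suc k mod n}"
      then have "t \<in> E" "t \<in> F" using meet by auto
      then have "E = F" using disj by auto
      then have "i \<noteq> j" "even i = even j" using ne sEF by auto
      then show False using meet g par[of k] by auto
    qed
  qed
  have cycle_cycle: False
    if i: "i < n" and j: "j < n"
      and ne: "{t} \<times> {i, Suc i mod n} \<noteq> {u} \<times> {j, Suc j mod n}"
      and eq: "c ({t} \<times> {i, Suc i mod n}) = c ({u} \<times> {j, Suc j mod n})"
      and g: "g \<in> edges (T \<box> cycle_graph n)"
      and meet: "({t} \<times> {i, Suc i mod n}) \<inter> g \<noteq> {}" "({u} \<times> {j, Suc j mod n}) \<inter> g \<noteq> {}"
    for t u i j g
  proof -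
    have eq4: "(i + 2 * of_bool (b t)) mod 4 = (j + 2 * of_bool (b u)) mod 4"
      using eq unfolding c2[OF i] c2[OF j] by (rule add_left_imp_eq)
    \<comment> \<open>The shift by \<open>b\<close> preserves parity, so equal colors rule out
      neighbouring indices.\<close>
    have "even ((x + 2 * y) mod 4) = even x" for x y :: nat by (simp add: dvd_mod_iff)
    with eq4 have even: "even i = even j" by metis
    from type[OF g] show False
    proof (elim disjE exE conjE)
      \<comment> \<open>The two edges are copies of one cycle edge over adjacent tree vertices,
        where \<open>b\<close> shifts the colors by 2 relative to each other.\<close>
      fix K k assume K: "g = K \<times> {k}" "K \<in> edges T"
      then have tu: "t \<in> K" "u \<in> K" and "{i, Suc i mod n} \<inter> {j, Suc j mod n} \<noteq> {}"
        using meet by auto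
      then have ij: "i = j" using cycle_edges_meet[OF i j] even par[of i] par[of j] by metis
      then have "t \<noteq> u" using ne by auto
      moreover have "card K = 2" using K T(1) by (auto simp: fin_simple_graph_def)
      ultimately have "K = {t, u}" using tu by (auto simp: card_2_iff)
      then have "b t \<noteq> b u" using b[of t u] K by simp
      moreover have "(i + 2) mod 4 \<noteq> i mod 4" by presburger
      ultimately show False using eq4 ij by (cases "b t") auto
    next
      \<comment> \<open>Both edges lie over the same tree vertex, with indices among the cyclic
        predecessor of \<open>k\<close>, \<open>k\<close> itself and its successor. Distinct indices
        of equal parity must be the outer two, which differ by 2 modulo 4.\<close>
      fix w k assume k: "g = {w} \<times> {k, Suc k mod n}" "k < n"
      then have tu: "t = u" and ik: "{i, Suc i mod n} \<inter> {k, Suc k mod n} \<noteq> {}"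
        and jk: "{j, Suc j mod n} \<inter> {k, Suc k mod n} \<noteq> {}" using meet by auto
      have "i \<noteq> j" using ne tu by auto
      have ij: "i mod 4 = j mod 4"
      proof (cases "b t")
        case True
        then have "(i + 2) mod 4 = (j + 2) mod 4" using eq4 tu by simp
        then show ?thesis by presburger
      qed (use eq4 tu in simp)
      have two: "x mod 4 \<noteq> y mod 4" if "x = Suc k mod n" "k = Suc y mod n" for x y
      proof -
        have "x mod 4 = Suc k mod 4" "k mod 4 = Suc y mod 4" using that mod4 by metis+
        then show ?thesis by presburger
      qed
      have inj: "i = j" if "Suc i mod n = Suc j mod n"
        using that i j by (auto simp: mod_Suc split: if_splits)
      show False
        using cycle_edges_meet[OF i k(2) ik] cycle_edges_meet[OF j k(2) jk]
          \<open>i \<noteq> j\<close> ij even par two[of i j] two[of j i] inj by metis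
    qed
  qed
  have "strong_edge_coloring (T \<box> cycle_graph n) c"
    unfolding strong_edge_coloring_iff[OF fin_simple_graph_cart_prod[OF T(1) C]]
  proof (intro ballI impI notI)
    fix e f g
    assume e: "e \<in> edges (T \<box> cycle_graph n)" and f: "f \<in> edges (T \<box> cycle_graph n)"
      and g: "g \<in> edges (T \<box> cycle_graph n)"
      and ne: "e \<noteq> f \<and> e \<inter> g \<noteq> {} \<and> f \<inter> g \<noteq> {}" and eq: "c e = c f"
    from type[OF e] type[OF f] show False
    proof (elim disjE exE conjE)
      fix E i F j assume "e = E \<times> {i}" "E \<in> edges T" "f = F \<times> {j}" "F \<in> edges T"
      then show False using tree_tree[of E F i j g] g ne eq by blast
    next
      fix E i t j
      assume "e = E \<times> {i}" "E \<in> edges T" "f = {t} \<times> {j, Suc j mod n}" "j < n"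
      then show False using lt[of E i] ge[of j t] eq by simp
    next
      fix E i t j
      assume "f = E \<times> {i}" "E \<in> edges T" "e = {t} \<times> {j, Suc j mod n}" "j < n"
      then show False using lt[of E i] ge[of j t] eq by simp
    next
      fix t i u j
      assume "e = {t} \<times> {i, Suc i mod n}" "i < n" "f = {u} \<times> {j, Suc j mod n}" "j < n"
      then show False using cycle_cycle[of i j t u g] g ne eq by blast
    qed
  qed
  with range that show thesis by (simp add: n_def)
qed

section \<open>The lower bound\<close>

text \<open>The edges collected in \<open>Q\<close> must have pairwise distinct colors. Edges at
  \<open>(v, 0)\<close> or \<open>(v, 1)\<close> all meet the edge joining these vertices; one at
  \<open>(v, i)\<close> and the opposite edge \<open>O'\<close> both meet the copy of
  \<open>vw\<close> in layer \<open>i\<close>.\<close>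

lemma strong_edge_coloring_cart_cycle_lower_bound:
  assumes T: "fin_simple_graph T" and vw: "{v, w} \<in> edges T" and n: "n \<ge> 4"
    and c: "strong_edge_coloring (T \<box> cycle_graph n) c"
    and k: "c ` edges (T \<box> cycle_graph n) \<subseteq> {..<k}"
  shows "2 * degree T v + 4 \<le> k"
proof -
  have n3: "n \<ge> 3" using n by simp
  note C = fin_simple_graph_cycle_graph[OF n3]
  note edgesG = edges_cart_prod[OF T C]
  define N where "N = {E \<in> edges T. v \<in> E}"
  define A where "A i = (\<lambda>E. E \<times> {i}) ` N" for i :: nat
  define O' where "O' = {w} \<times> {0, Suc 0}"
  \<comment> \<open>Three edges rather than four, as the one joining \<open>(v, 0)\<close> and
    \<open>(v, 1)\<close> is common to both vertices.\<close>
  define B where "B = (\<lambda>I. {v} \<times> I) ` {{0, Suc 0}, {Suc 0, 2}, {n - 1, 0}}"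
  define Q where "Q = A 0 \<union> A 1 \<union> B \<union> {O'}"
  have v: "v \<in> verts T" "w \<in> verts T" "v \<noteq> w" using vw T by (auto simp: fin_simple_graph_def)
  have finN: "finite N" using fin_simple_graph_finite_edges[OF T] by (simp add: N_def)
  have N0: "E \<noteq> {}" if "E \<in> N" for E using that by (auto simp: N_def)
  have cardA: "card (A i) = degree T v" for i
    unfolding A_def degree_def N_def[symmetric]
    by (rule card_image) (auto simp: inj_on_def times_eq_iff)
  have finA: "finite (A i)" for i using finN by (simp add: A_def)
  have cardB: "card B = 3" "finite B"
    using n by (auto simp: B_def card_insert_if times_eq_iff doubleton_eq_iff)
  \<comment> \<open>The size of the second projection tells copies of tree edges from copies of
    cycle edges.\<close>
  have sndA: "card (snd ` x) = 1" if "x \<in> A i" for x i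
    using that N0 by (auto simp: A_def snd_image_times)
  have sndB: "card (snd ` x) = 2" if "x \<in> B" for x
    using that n by (auto simp: B_def snd_image_times)
  have "A 0 \<inter> A 1 = {}" using N0 by (auto simp: A_def times_eq_iff)
  moreover have "(A 0 \<union> A 1) \<inter> B = {}"
    by (auto dest!: sndA sndB)
  moreover have "O' \<notin> A 0 \<union> A 1"
    by (auto dest!: sndA simp: O'_def snd_image_times)
  moreover have "O' \<notin> B"
    using v by (auto simp: B_def O'_def times_eq_iff)
  ultimately have "card Q = 2 * degree T v + 4"
    using finA cardB unfolding Q_def by (simp add: card_Un_disjoint cardA)
  moreover have QE: "Q \<subseteq> edges (T \<box> cycle_graph n)"
  proof -
    have "{i, Suc i mod n} \<in> edges (cycle_graph n)" if "i < n" for i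
      using that by (auto simp: cycle_graph_simps)
    from this[of 0] this[of 1] this[of "n - 1"]
    have "{0, Suc 0} \<in> edges (cycle_graph n)" "{Suc 0, 2} \<in> edges (cycle_graph n)"
      "{n - 1, 0} \<in> edges (cycle_graph n)"
      using n by (simp_all add: numeral_2_eq_2)
    then have "B \<union> {O'} \<subseteq> edges (T \<box> cycle_graph n)"
      using v unfolding B_def O'_def edgesG by blast
    moreover have "A i \<subseteq> edges (T \<box> cycle_graph n)" if "i < n" for i
      using that unfolding A_def N_def edgesG cycle_graph_simps(1) by blast
    ultimately show ?thesis using n by (simp add: Q_def)
  qed
  moreover have "inj_on c Q"
  proof (rule inj_onI, rule ccontr)
    fix e f assume e: "e \<in> Q" and f: "f \<in> Q" and eq: "c e = c f" and ne: "e \<noteq> f"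
    have no: "\<not> (e \<inter> g \<noteq> {} \<and> f \<inter> g \<noteq> {})" if "g \<in> edges (T \<box> cycle_graph n)" for g
      using c e f eq ne QE that
      unfolding strong_edge_coloring_iff[OF fin_simple_graph_cart_prod[OF T C]] by blast
    have x: "x = O' \<or> (v, 0) \<in> x \<or> (v, 1) \<in> x" if "x \<in> Q" for x
      using that by (auto simp: Q_def A_def B_def N_def)
    have g0: "{v} \<times> {0, Suc 0} \<in> edges (T \<box> cycle_graph n)"
      using QE by (auto simp: Q_def B_def)
    have g1: "{v, w} \<times> {i} \<in> edges (T \<box> cycle_graph n)" if "i = 0 \<or> i = 1" for i :: nat
    proof -
      have "i < n" using that n by auto
      then show ?thesis using vw unfolding edgesG cycle_graph_simps(1) by blast
    qed
    show False
      using x[OF e] x[OF f] ne no[OF g0] no[OF g1[of 0]] no[OF g1[of 1]]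
      by (auto simp: O'_def)
  qed
  ultimately show ?thesis
    using k card_mono[of "{..<k}" "c ` Q"] by (fastforce simp: card_image)
qed

theorem theorem9:
  fixes T :: "'a ugraph" and l :: nat
  assumes "is_tree T" and "edges T \<noteq> {}" and "l \<ge> 1"
  shows "strong_chromatic_index (T \<box> cycle_graph (4 * l)) = 2 * max_degree T + 4"
proof -
  have T: "fin_simple_graph T" "\<nexists>xs. is_cycle_in T xs"
    using assms(1) by (auto simp: is_tree_def)
  have fin: "finite (verts T)" "finite (edges T)"
    using T(1) fin_simple_graph_finite_edges by (auto simp: fin_simple_graph_def)
  have le: "degree T v \<le> max_degree T" if "v \<in> verts T" for v
    using that fin by (simp add: max_degree_def)
  obtain f where f: "f \<in> edges T" using assms(2) by blast
  obtain x y where xy: "f = {x, y}" "x \<noteq> y" "x \<in> verts T" "y \<in> verts T"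
    by (rule edge_endsE[OF T(1) f])
  then have "max_degree T \<in> degree T ` verts T"
    unfolding max_degree_def using fin by (intro Max_in) auto
  then obtain v where v: "v \<in> verts T" "degree T v = max_degree T" by auto
  \<comment> \<open>Since some degree is positive, the vertex \<open>v\<close> of maximum degree has
    a neighbour \<open>w\<close>, as the lower bound requires.\<close>
  have "0 < degree T x" using xy f fin by (auto simp: degree_def card_gt_0_iff)
  then have "0 < degree T v" using le[OF xy(3)] v by simp
  then obtain e where e: "e \<in> edges T" "v \<in> e" by (auto simp: degree_def card_gt_0_iff)
  obtain w where w: "e = {v, w}" "v \<noteq> w" "w \<in> verts T"
    by (rule edge_other_endE[OF T(1) e])
  then have vw: "{v, w} \<in> edges T" using e by simp
  obtain c where "strong_edge_coloring (T \<box> cycle_graph (4 * l)) c"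
    "c ` edges (T \<box> cycle_graph (4 * l)) \<subseteq> {..<2 * max_degree T + 4}"
    by (rule strong_edge_coloring_forest_cycle[OF T le assms(3)])
  then show ?thesis
    unfolding strong_chromatic_index_def
    using strong_edge_coloring_cart_cycle_lower_bound[OF T(1) vw, of "4 * l"] assms(3) v(2)
    by (intro Least_equality) auto
qed

end
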